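(* Let $C>0$ and consider the discrete $k$-wallet model with $k=1$ and maximum transaction size $T=C$ (so $r=kT/C=1$). Then there is no deterministic online $1$-wallet settlement algorithm that is $\alpha$-competitive for any finite $\alpha$.
   Context: Discrete $k$-wallet model $\mathcal{M}^{C,k}_T$: Time is divided into discrete slots $t=1,2,\dots$. A transaction sequence is $\mathsf{Tx}=(\mathsf{tx}_1,\dots,\mathsf{tx}_n)$, where $\mathsf{tx}_t\in[0,T]$ is the value of the transaction arriving at slot $t$ (value $0$ means no transaction). A total collateral $C$ is divided into $k$ wallets, each of capacity $C/k$. Each wallet is either online with some available (uncommitted) collateral $R\in[0,C/k]$, or offline. When a transaction of value $v$ arrives, the policy must immediately either settle it, using an online wallet with $R\ge v$ (whose available collateral becomes $R-v$), or discard it. At any time $t$ the policy may flush a wallet; the wallet is then offline during the slots of the interval $(t,t+F]$ (with $F$ a fixed positive integer flush period), after which it is online again with available collateral reset to $C/k$. For a policy $\mathrm{A}$, $V_{\mathrm{A}}(\mathsf{Tx})$ denotes the total value of transactions it settles. An algorithm is online if its decisions at time $N$ depend only on $\mathsf{tx}_1,\dots,\mathsf{tx}_N$. $\mathrm{OPT}$ denotes an optimal offline $k$-wallet policy, i.e. $V_{\mathrm{OPT}}(\mathsf{Tx})$ is the maximum settled value achievable by any $k$-wallet policy with full knowledge of $\mathsf{Tx}$. An algorithm $\mathrm{A}$ is $\alpha$-competitive in this model if for every sequence $\mathsf{Tx}$ with values at most $T$, $V_{\mathrm{OPT}}(\mathsf{Tx})\le \alpha V_{\mathrm{A}}(\mathsf{Tx})+O(1)$,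 where the $O(1)$ constant may depend on $C,k,T$ (and $F$) but not on $\mathsf{Tx}$ or its length. *)

theory Defs
  imports Complex_Main
begin

text \<open>\<^term>\<open>Online R\<close>: available collateral \<open>R\<close>.
  \<^term>\<open>Offline m\<close>: the wallet is offline in the current slot and there are \<open>m\<close>
  offline slots left, the current one included.\<close>

datatype wallet = Online real | Offline nat

text \<open>The decision taken at one slot: the wallet used to settle the arriving transaction
  (\<^term>\<open>None\<close> means that it is discarded), and the set of wallets flushed at that slot.
  Wallets are numbered \<open>0, \<dots>, k - 1\<close>.\<close>

datatype decision = Decision (settle_with: "nat option") (flushed: "nat set")

type_synonym schedule = "decision list"

definition initial_state :: "real \<Rightarrow> nat \<Rightarrow> nat \<Rightarrow> wallet" where
  "initial_state C k = (\<lambda>w. Online (C / real k))"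

definition allowed :: "nat \<Rightarrow> (nat \<Rightarrow> wallet) \<Rightarrow> real \<Rightarrow> decision \<Rightarrow> bool" where
  "allowed k \<sigma> v d \<longleftrightarrow>
     flushed d \<subseteq> {..<k} \<and>
     (\<forall>w. settle_with d = Some w \<longrightarrow> w < k \<and> (\<exists>R. \<sigma> w = Online R \<and> v \<le> R))"

text \<open>State after settling, before the flushes of the same slot.\<close>

definition after_settling :: "(nat \<Rightarrow> wallet) \<Rightarrow> real \<Rightarrow> decision \<Rightarrow> nat \<Rightarrow> wallet" where
  "after_settling \<sigma> v d w =
     (case \<sigma> w of
        Online R \<Rightarrow> Online (if settle_with d = Some w then R - v else R)
      | Offline m \<Rightarrow> Offline m)"

text \<open>State at the beginning of the next slot. A wallet flushed at slot \<open>t\<close> can still settle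
  the transaction of slot \<open>t\<close>; it is offline in the slots \<open>t + 1, \<dots>, t + F\<close> and is online
  with full collateral at slot \<open>t + F + 1\<close>. Flushing an offline wallet restarts its flush
  period.\<close>

definition next_state ::
  "real \<Rightarrow> nat \<Rightarrow> nat \<Rightarrow> (nat \<Rightarrow> wallet) \<Rightarrow> real \<Rightarrow> decision \<Rightarrow> nat \<Rightarrow> wallet" where
  "next_state C k F \<sigma> v d w =
     (if w \<in> flushed d then Offline F
      else case after_settling \<sigma> v d w of
             Online R \<Rightarrow> Online R
           | Offline m \<Rightarrow> (if m \<le> 1 then Online (C / real k) else Offline (m - 1)))"

fun feasible_from ::
  "real \<Rightarrow> nat \<Rightarrow> nat \<Rightarrow> (nat \<Rightarrow> wallet) \<Rightarrow> real list \<Rightarrow> schedule \<Rightarrow> bool" where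
  "feasible_from C k F \<sigma> [] [] \<longleftrightarrow> True"
| "feasible_from C k F \<sigma> (v # Tx) (d # ds) \<longleftrightarrow>
     allowed k \<sigma> v d \<and> feasible_from C k F (next_state C k F \<sigma> v d) Tx ds"
| "feasible_from C k F \<sigma> _ _ \<longleftrightarrow> False"

definition feasible :: "real \<Rightarrow> nat \<Rightarrow> nat \<Rightarrow> real list \<Rightarrow> schedule \<Rightarrow> bool" where
  "feasible C k F Tx ds \<longleftrightarrow> feasible_from C k F (initial_state C k) Tx ds"

definition settled_value :: "real list \<Rightarrow> schedule \<Rightarrow> real" where
  "settled_value Tx ds =
     (\<Sum>i<length Tx. if settle_with (ds ! i) \<noteq> None then Tx ! i else 0)"

definition tx_sequence :: "real \<Rightarrow> real list \<Rightarrow> bool" where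
  "tx_sequence T Tx \<longleftrightarrow> (\<forall>v\<in>set Tx. 0 \<le> v \<and> v \<le> T)"

text \<open>The maximum ranges over a finite nonempty set, see \<open>finite_feasible\<close> and
  \<open>feasible_nonempty\<close> below.\<close>

definition V_OPT :: "real \<Rightarrow> nat \<Rightarrow> nat \<Rightarrow> real list \<Rightarrow> real" where
  "V_OPT C k F Tx = Max {settled_value Tx ds | ds. feasible C k F Tx ds}"

text \<open>A deterministic policy maps the whole transaction sequence to its schedule; being
  online is a separate condition.\<close>

type_synonym policy = "real list \<Rightarrow> schedule"

definition wallet_policy :: "real \<Rightarrow> nat \<Rightarrow> nat \<Rightarrow> real \<Rightarrow> policy \<Rightarrow> bool" where
  "wallet_policy C k F T A \<longleftrightarrow> (\<forall>Tx. tx_sequence T Tx \<longrightarrow> feasible C k F Tx (A Tx))"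

text \<open>Slot \<open>N\<close> is list position \<open>N - 1\<close>.\<close>

definition online :: "real \<Rightarrow> policy \<Rightarrow> bool" where
  "online T A \<longleftrightarrow>
     (\<forall>Tx Tx' N. tx_sequence T Tx \<and> tx_sequence T Tx' \<and>
        1 \<le> N \<and> N \<le> length Tx \<and> N \<le> length Tx' \<and> take N Tx = take N Tx' \<longrightarrow>
        A Tx ! (N - 1) = A Tx' ! (N - 1))"

definition online_algorithm :: "real \<Rightarrow> nat \<Rightarrow> nat \<Rightarrow> real \<Rightarrow> policy \<Rightarrow> bool" where
  "online_algorithm C k F T A \<longleftrightarrow> wallet_policy C k F T A \<and> online T A"

definition V :: "policy \<Rightarrow> real list \<Rightarrow> real" where
  "V A Tx = settled_value Tx (A Tx)"

definition competitive :: "real \<Rightarrow> nat \<Rightarrow> nat \<Rightarrow> real \<Rightarrow> real \<Rightarrow> policy \<Rightarrow> bool" where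
  "competitive C k F T \<alpha> A \<longleftrightarrow>
     (\<exists>c. \<forall>Tx. tx_sequence T Tx \<longrightarrow> V_OPT C k F Tx \<le> \<alpha> * V A Tx + c)"

lemma feasible_from_length: "feasible_from C k F \<sigma> Tx ds \<Longrightarrow> length ds = length Tx"
  by (induction C k F \<sigma> Tx ds rule: feasible_from.induct) auto

lemma feasible_from_decisions:
  "feasible_from C k F \<sigma> Tx ds \<Longrightarrow>
   set ds \<subseteq> (\<lambda>(s, f). Decision s f) ` (insert None (Some ` {..<k}) \<times> Pow {..<k})"
proof (induction C k F \<sigma> Tx ds rule: feasible_from.induct)
  case (2 C k F \<sigma> v Tx d ds)
  obtain s f where d: "d = Decision s f" by (cases d)
  have "s \<in> insert None (Some ` {..<k})" "f \<in> Pow {..<k}"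
    using 2(2) by (cases s; auto simp: d allowed_def)+
  then have "d \<in> (\<lambda>(s, f). Decision s f) ` (insert None (Some ` {..<k}) \<times> Pow {..<k})"
    by (auto simp: d)
  then show ?case using 2 by auto
qed auto

lemma finite_feasible: "finite {ds. feasible C k F Tx ds}"
proof (rule finite_subset)
  let ?D = "(\<lambda>(s, f). Decision s f) ` (insert None (Some ` {..<k}) \<times> Pow {..<k})"
  show "{ds. feasible C k F Tx ds} \<subseteq> {ds. set ds \<subseteq> ?D \<and> length ds = length Tx}"
    using feasible_from_length feasible_from_decisions unfolding feasible_def by blast
  show "finite {ds. set ds \<subseteq> ?D \<and> length ds = length Tx}"
    by (rule finite_lists_length_eq) auto
qed

lemma feasible_from_discard_all:
  "feasible_from C k F \<sigma> Tx (replicate (length Tx) (Decision None {}))"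
  by (induction Tx arbitrary: \<sigma>) (auto simp: allowed_def)

lemma feasible_nonempty: "{ds. feasible C k F Tx ds} \<noteq> {}"
  using feasible_from_discard_all unfolding feasible_def by blast

lemma V_OPT_attained: "\<exists>ds. feasible C k F Tx ds \<and> V_OPT C k F Tx = settled_value Tx ds"
proof -
  have "{settled_value Tx ds | ds. feasible C k F Tx ds}
      = settled_value Tx ` {ds. feasible C k F Tx ds}"
    by auto
  then have "V_OPT C k F Tx \<in> settled_value Tx ` {ds. feasible C k F Tx ds}"
    unfolding V_OPT_def using finite_feasible feasible_nonempty
    by (metis (no_types, lifting) Max_in finite_imageI image_is_empty)
  then show ?thesis by auto
qed

lemma V_OPT_upper: "feasible C k F Tx ds \<Longrightarrow> settled_value Tx ds \<le> V_OPT C k F Tx"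
proof -
  assume "feasible C k F Tx ds"
  moreover have "{settled_value Tx ds | ds. feasible C k F Tx ds}
      = settled_value Tx ` {ds. feasible C k F Tx ds}"
    by auto
  ultimately show ?thesis
    unfolding V_OPT_def using finite_feasible by (auto intro!: Max_ge)
qed

end

theory Submission imports Defs begin

text \<open>The adversary plays in phases, each starting when its own reference wallet is full. It
  offers small transactions of value \<open>C / M\<close>, at most \<open>M\<close> of them, as long as the algorithm's
  wallet is online and full. If the algorithm settles a small transaction or flushes, its wallet
  is no longer full, and the adversary offers \<open>C\<close>, which the algorithm must discard: the reference
  policy has skipped the small ones and settles \<open>C\<close>. Otherwise the algorithm discarded all \<open>M\<close>
  small transactions, which the reference policy settles. Either way the reference policy gains
  \<open>C\<close> and the algorithm at most \<open>C / M\<close>; empty slots then let the reference wallet be flushed.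
  Iterating the phases defeats every ratio below \<open>M\<close>.\<close>

section \<open>Runs extended slot by slot at the end\<close>

fun final_state ::
  "real \<Rightarrow> nat \<Rightarrow> nat \<Rightarrow> (nat \<Rightarrow> wallet) \<Rightarrow> real list \<Rightarrow> schedule \<Rightarrow> nat \<Rightarrow> wallet" where
  "final_state C k F \<sigma> (v # Tx) (d # ds) = final_state C k F (next_state C k F \<sigma> v d) Tx ds"
| "final_state C k F \<sigma> _ _ = \<sigma>"

text \<open>\<open>feasible_from\<close> consumes its lists from the front, while the adversary
  appends transactions at the end; the snoc rules bridge the two.\<close>

lemma final_state_snoc:
  "length ds = length Tx \<Longrightarrow>
   final_state C k F \<sigma> (Tx @ [v]) (ds @ [d])
     = next_state C k F (final_state C k F \<sigma> Tx ds) v d"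
  by (induction ds Tx arbitrary: \<sigma> rule: list_induct2) auto

lemma feasible_from_snoc:
  "length ds = length Tx \<Longrightarrow>
   feasible_from C k F \<sigma> (Tx @ [v]) (ds @ [d]) \<longleftrightarrow>
     feasible_from C k F \<sigma> Tx ds \<and> allowed k (final_state C k F \<sigma> Tx ds) v d"
  by (induction ds Tx arbitrary: \<sigma> rule: list_induct2) auto

lemma settled_value_snoc:
  "length ds = length Tx \<Longrightarrow>
   settled_value (Tx @ [v]) (ds @ [d])
     = settled_value Tx ds + (if settle_with d \<noteq> None then v else 0)"
  by (auto simp: settled_value_def nth_append intro!: sum.cong)

lemma tx_sequence_snoc [simp]:
  "tx_sequence T (Tx @ [v]) \<longleftrightarrow> tx_sequence T Tx \<and> 0 \<le> v \<and> v \<le> T"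
  by (auto simp: tx_sequence_def)

lemma tx_sequence_append_replicate:
  assumes "tx_sequence T Tx" "0 \<le> v" "v \<le> T"
  shows "tx_sequence T (Tx @ replicate n v)"
  using assms by (auto simp: tx_sequence_def)

lemma append_replicate_Suc: "Tx @ replicate (Suc n) v = (Tx @ replicate n v) @ [v]"
  by (simp add: replicate_append_same)

section \<open>The reference policy\<close>

text \<open>Hides the schedule of the reference policy and keeps only what the phases use.
  Optimality is not claimed: an attainable value is just a lower bound for
  \<open>V_OPT\<close>.\<close>

definition attainable :: "real \<Rightarrow> nat \<Rightarrow> real list \<Rightarrow> real \<Rightarrow> wallet \<Rightarrow> bool" where
  "attainable C F Tx x w \<longleftrightarrow>
     (\<exists>ds. feasible C 1 F Tx ds \<and> settled_value Tx ds = x \<and>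
           final_state C 1 F (initial_state C 1) Tx ds 0 = w)"

lemma attainable_le_V_OPT: "attainable C F Tx x w \<Longrightarrow> x \<le> V_OPT C 1 F Tx"
  unfolding attainable_def using V_OPT_upper by blast

lemma attainable_Nil: "attainable C F [] 0 (Online C)"
  unfolding attainable_def
  by (rule exI[of _ "[]"]) (simp add: feasible_def settled_value_def initial_state_def)

text \<open>The second assumption ranges over all states that agree at wallet 0, because
  \<open>attainable\<close> records nothing else.\<close>

lemma attainable_snoc:
  assumes "attainable C F Tx x w"
    and "\<And>\<sigma>. \<sigma> 0 = w \<Longrightarrow> allowed 1 \<sigma> v d \<and> next_state C 1 F \<sigma> v d 0 = w'"
  shows "attainable C F (Tx @ [v]) (x + (if settle_with d \<noteq> None then v else 0)) w'"
proof -
  obtain ds where ds: "feasible C 1 F Tx ds" "settled_value Tx ds = x"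
    "final_state C 1 F (initial_state C 1) Tx ds 0 = w"
    using assms(1) unfolding attainable_def by blast
  have len: "length ds = length Tx"
    using ds(1) feasible_from_length unfolding feasible_def by blast
  show ?thesis unfolding attainable_def
    using ds(1,2) assms(2)[of "final_state C 1 F (initial_state C 1) Tx ds", OF ds(3)]
    by (intro exI[of _ "ds @ [d]"])
      (simp add: feasible_def feasible_from_snoc[OF len] final_state_snoc[OF len]
        settled_value_snoc[OF len])
qed

lemma attainable_settle:
  assumes "attainable C F Tx x (Online R)" "v \<le> R"
  shows "attainable C F (Tx @ [v]) (x + v) (Online (R - v))"
  using attainable_snoc[OF assms(1), of v "Decision (Some 0) {}"] assms(2)
  by (simp add: allowed_def next_state_def after_settling_def)

lemma attainable_skip:
  assumes "attainable C F Tx x (Online R)"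
  shows "attainable C F (Tx @ [v]) x (Online R)"
  using attainable_snoc[OF assms(1), of v "Decision None {}"]
  by (simp add: allowed_def next_state_def after_settling_def)

lemma attainable_flush:
  assumes "attainable C F Tx x w"
  shows "attainable C F (Tx @ [v]) x (Offline F)"
  using attainable_snoc[OF assms(1), of v "Decision None {0}"]
  by (simp add: allowed_def next_state_def)

lemma attainable_wait:
  assumes "attainable C F Tx x (Offline (Suc m))"
  shows "attainable C F (Tx @ [v]) x (if m = 0 then Online C else Offline m)"
  using attainable_snoc[OF assms(1), of v "Decision None {}"]
  by (simp add: allowed_def next_state_def after_settling_def)

lemma attainable_settle_replicate:
  assumes "attainable C F Tx x (Online R)" "0 \<le> v" "real n * v \<le> R"
  shows "attainable C F (Tx @ replicate n v) (x + real n * v) (Online (R - real n * v))"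
  using assms(3)
proof (induction n)
  case 0
  then show ?case using assms(1) by simp
next
  case (Suc n)
  have le: "real n * v + v \<le> R" using Suc.prems by (simp add: algebra_simps)
  then have "attainable C F (Tx @ replicate n v) (x + real n * v) (Online (R - real n * v))"
    using Suc.IH assms(2) by linarith
  from attainable_settle[OF this, of v] le show ?case
    unfolding append_replicate_Suc by (simp add: algebra_simps)
qed

lemma attainable_skip_replicate:
  assumes "attainable C F Tx x (Online R)"
  shows "attainable C F (Tx @ replicate n v) x (Online R)"
proof (induction n)
  case (Suc n)
  then show ?case unfolding append_replicate_Suc by (rule attainable_skip)
qed (simp add: assms)

lemma attainable_wait_replicate:
  assumes "attainable C F Tx x (Offline (Suc m))"
  shows "attainable C F (Tx @ replicate (Suc m) v) x (Online C)"
  using assms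
proof (induction m arbitrary: Tx)
  case 0
  then show ?case using attainable_wait[of C F Tx x 0 v] by simp
next
  case (Suc m)
  from Suc.IH[of "Tx @ [v]"] attainable_wait[OF Suc.prems, of v] show ?case by simp
qed

text \<open>One slot for the flush and \<open>F\<close> offline slots give \<open>Suc F\<close>. A
  flush is allowed in every state, so \<open>w\<close> is arbitrary.\<close>

lemma attainable_recharge:
  assumes "attainable C F Tx x w" "F > 0"
  shows "attainable C F (Tx @ replicate (Suc F) v) x (Online C)"
proof -
  obtain m where F: "F = Suc m" using assms(2) gr0_conv_Suc by blast
  have "attainable C F ((Tx @ [v]) @ replicate (Suc m) v) x (Online C)"
    using attainable_wait_replicate attainable_flush[OF assms(1)] unfolding F by blast
  then show ?thesis by (simp add: F)
qed

section \<open>The behaviour of an arbitrary online algorithm\<close>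

locale one_wallet_algorithm =
  fixes C :: real and F :: nat and A :: policy
  assumes C_pos: "0 < C" and F_pos: "0 < F" and A: "online_algorithm C 1 F C A"
begin

definition wallet_after :: "real list \<Rightarrow> wallet" where
  "wallet_after Tx = final_state C 1 F (initial_state C 1) Tx (A Tx) 0"

lemma feasible_A: "tx_sequence C Tx \<Longrightarrow> feasible C 1 F Tx (A Tx)"
  using A unfolding online_algorithm_def wallet_policy_def by blast

lemma length_A: "tx_sequence C Tx \<Longrightarrow> length (A Tx) = length Tx"
  using feasible_A feasible_from_length unfolding feasible_def by blast

text \<open>A policy sees the whole sequence at once; being online is what makes its schedule on a
  prefix survive an extension, so that its run can be followed slot by slot.\<close>

lemma A_snoc:
  assumes "tx_sequence C (Tx @ [v])"
  shows "\<exists>d. A (Tx @ [v]) = A Tx @ [d]"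
proof -
  have Tx: "tx_sequence C Tx" using assms by simp
  have "A (Tx @ [v]) ! i = A Tx ! i" if "i < length Tx" for i
  proof -
    have "\<forall>Tx Tx' N. tx_sequence C Tx \<and> tx_sequence C Tx' \<and> 1 \<le> N \<and> N \<le> length Tx \<and>
      N \<le> length Tx' \<and> take N Tx = take N Tx' \<longrightarrow> A Tx ! (N - 1) = A Tx' ! (N - 1)"
      using A unfolding online_algorithm_def online_def by blast
    from this[rule_format, of "Tx @ [v]" Tx "Suc i"] show ?thesis using assms Tx that by simp
  qed
  then have "take (length Tx) (A (Tx @ [v])) = A Tx"
    using length_A[OF assms] length_A[OF Tx] by (intro nth_equalityI) auto
  moreover have "length (A (Tx @ [v])) = Suc (length Tx)"
    using length_A[OF assms] by simp
  ultimately have "A (Tx @ [v]) = A Tx @ [A (Tx @ [v]) ! length Tx]"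
    by (metis lessI order_refl take_Suc_conv_app_nth take_all)
  then show ?thesis by blast
qed

lemma step:
  assumes "tx_sequence C (Tx @ [v])"
  obtains d \<sigma> where "\<sigma> 0 = wallet_after Tx" "allowed 1 \<sigma> v d"
    "wallet_after (Tx @ [v]) = next_state C 1 F \<sigma> v d 0"
    "V A (Tx @ [v]) = V A Tx + (if settle_with d \<noteq> None then v else 0)"
proof -
  obtain d where d: "A (Tx @ [v]) = A Tx @ [d]" using A_snoc[OF assms] by blast
  have len: "length (A Tx) = length Tx" using length_A assms by simp
  show thesis
    using feasible_A[OF assms] that[of "final_state C 1 F (initial_state C 1) Tx (A Tx)" d]
    by (simp add: wallet_after_def V_def d feasible_def feasible_from_snoc[OF len]
        final_state_snoc[OF len] settled_value_snoc[OF len])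
qed

text \<open>Hence a wallet in a state other than \<open>Online C\<close> is offline or holds
  strictly less than \<open>C\<close>.\<close>

lemma wallet_after_le:
  assumes "tx_sequence C Tx" "wallet_after Tx = Online R"
  shows "R \<le> C"
  using assms
proof (induction Tx arbitrary: R rule: rev_induct)
  case Nil
  then show ?case by (simp add: wallet_after_def initial_state_def)
next
  case (snoc v Tx)
  obtain d \<sigma> where "\<sigma> 0 = wallet_after Tx"
    "wallet_after (Tx @ [v]) = next_state C 1 F \<sigma> v d 0"
    using step[OF snoc.prems(1)] by blast
  then show ?case using snoc
    by (fastforce simp: next_state_def after_settling_def split: if_splits wallet.splits)
qed

text \<open>Settling leaves at most \<open>C - v\<close>, which is below \<open>C\<close>; a flush
  in the same slot leaves the wallet offline instead.\<close>

lemma settles_small: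
  assumes "tx_sequence C (Tx @ [v])" "0 < v" "V A (Tx @ [v]) \<noteq> V A Tx"
  shows "V A (Tx @ [v]) = V A Tx + v" "wallet_after (Tx @ [v]) \<noteq> Online C"
proof -
  obtain d \<sigma> where st: "\<sigma> 0 = wallet_after Tx" "allowed 1 \<sigma> v d"
    "wallet_after (Tx @ [v]) = next_state C 1 F \<sigma> v d 0"
    "V A (Tx @ [v]) = V A Tx + (if settle_with d \<noteq> None then v else 0)"
    using step[OF assms(1)] by blast
  show "V A (Tx @ [v]) = V A Tx + v" using st(4) assms(3) by (auto split: if_splits)
  have "settle_with d = Some 0" using st(2,4) assms(3)
    by (auto simp: allowed_def split: if_splits)
  moreover obtain R where R: "wallet_after Tx = Online R"
    using st(1,2) calculation by (auto simp: allowed_def)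
  moreover have "R \<le> C" using wallet_after_le[OF _ R] assms(1) by simp
  ultimately show "wallet_after (Tx @ [v]) \<noteq> Online C"
    using st(1,3) assms(2) by (auto simp: next_state_def after_settling_def)
qed

text \<open>Here it matters that a transaction may be as large as the capacity: only a full wallet
  can take it.\<close>

lemma discards_full:
  assumes "tx_sequence C Tx" "wallet_after Tx \<noteq> Online C"
  shows "V A (Tx @ [C]) = V A Tx"
proof -
  have "tx_sequence C (Tx @ [C])" using assms(1) C_pos by simp
  from step[OF this] obtain d \<sigma> where st: "\<sigma> 0 = wallet_after Tx" "allowed 1 \<sigma> C d"
    "V A (Tx @ [C]) = V A Tx + (if settle_with d \<noteq> None then C else 0)" by blast
  have "settle_with d = None"
  proof (rule ccontr)
    assume "settle_with d \<noteq> None"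
    then obtain R where "wallet_after Tx = Online R" "C \<le> R"
      using st(1,2) by (auto simp: allowed_def)
    then show False using wallet_after_le[OF assms(1)] assms(2) by force
  qed
  then show ?thesis using st(3) by simp
qed

lemma V_append_zeros:
  assumes "tx_sequence C Tx"
  shows "V A (Tx @ replicate n 0) = V A Tx"
proof (induction n)
  case (Suc n)
  have "tx_sequence C ((Tx @ replicate n 0) @ [0])"
    using tx_sequence_append_replicate[OF assms] C_pos unfolding tx_sequence_snoc by simp
  from step[OF this] show ?case using Suc unfolding append_replicate_Suc by force
qed simp

section \<open>The adversary's phases\<close>

text \<open>The induction looks for the first settled small transaction. A flush without settlement
  needs no case of its own, since it leaves the value unchanged.\<close>

lemma small_transactions:
  assumes "tx_sequence C Tx" "0 < v" "v \<le> C"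
  shows "(\<exists>i\<le>n. wallet_after (Tx @ replicate i v) \<noteq> Online C \<and>
                V A (Tx @ replicate i v) \<le> V A Tx + v) \<or>
         V A (Tx @ replicate n v) = V A Tx"
proof (induction n)
  case (Suc n)
  let ?Tx = "Tx @ replicate n v"
  have tx: "tx_sequence C (?Tx @ [v])"
    using tx_sequence_append_replicate assms unfolding tx_sequence_snoc by simp
  show ?case
  proof (cases "V A ?Tx = V A Tx \<and> V A (?Tx @ [v]) \<noteq> V A ?Tx")
    case True
    with settles_small[OF tx assms(2)] have
      "wallet_after (Tx @ replicate (Suc n) v) \<noteq> Online C \<and>
       V A (Tx @ replicate (Suc n) v) \<le> V A Tx + v"
      unfolding append_replicate_Suc by simp
    then show ?thesis by blast
  next
    case False
    then show ?thesis using Suc unfolding append_replicate_Suc by (metis le_SucI)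
  qed
qed simp

text \<open>Nothing is assumed about the algorithm's wallet at the start: if it is not full,
  \<open>i = 0\<close> already qualifies and \<open>C\<close> can be offered at once.\<close>

lemma phase:
  assumes "tx_sequence C Tx" "attainable C F Tx x (Online C)" "M > 0"
  shows "\<exists>Tx'. tx_sequence C Tx' \<and> attainable C F Tx' (x + C) (Online C) \<and>
               V A Tx' \<le> V A Tx + C / real M"
proof -
  let ?v = "C / real M"
  have v: "0 < ?v" "?v \<le> C" using C_pos assms(3) by (auto simp: field_simps)
  obtain Tx1 w where Tx1: "tx_sequence C Tx1" "attainable C F Tx1 (x + C) w"
    "V A Tx1 \<le> V A Tx + ?v"
  proof (cases "\<exists>i\<le>M. wallet_after (Tx @ replicate i ?v) \<noteq> Online C \<and>
                V A (Tx @ replicate i ?v) \<le> V A Tx + ?v")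
    case True
    then obtain i where i: "wallet_after (Tx @ replicate i ?v) \<noteq> Online C"
      "V A (Tx @ replicate i ?v) \<le> V A Tx + ?v" by blast
    have tx: "tx_sequence C (Tx @ replicate i ?v)"
      using tx_sequence_append_replicate[OF assms(1)] v by simp
    show thesis
    proof (rule that)
      show "tx_sequence C ((Tx @ replicate i ?v) @ [C])"
        using tx C_pos unfolding tx_sequence_snoc by simp
      show "attainable C F ((Tx @ replicate i ?v) @ [C]) (x + C) (Online (C - C))"
        by (rule attainable_settle[OF attainable_skip_replicate[OF assms(2)] order_refl])
      show "V A ((Tx @ replicate i ?v) @ [C]) \<le> V A Tx + ?v"
        using discards_full[OF tx i(1)] i(2) by simp
    qed
  next
    case False
    then have "V A (Tx @ replicate M ?v) = V A Tx"
      using small_transactions[OF assms(1) v] by blast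
    moreover have "tx_sequence C (Tx @ replicate M ?v)"
      using tx_sequence_append_replicate[OF assms(1)] v by simp
    ultimately show thesis
      using that attainable_settle_replicate[OF assms(2), of ?v M] v assms(3) by simp
  qed
  show ?thesis
    using attainable_recharge[OF Tx1(2) F_pos, of 0] V_append_zeros[OF Tx1(1), of "Suc F"] Tx1(3)
      tx_sequence_append_replicate[OF Tx1(1), of 0 "Suc F"] C_pos
    by (intro exI[of _ "Tx1 @ replicate (Suc F) 0"]) simp
qed

lemma phases:
  assumes "M > 0"
  shows "\<exists>Tx. tx_sequence C Tx \<and> attainable C F Tx (real n * C) (Online C) \<and>
              V A Tx \<le> real n * (C / real M)"
proof (induction n)
  case 0
  show ?case using attainable_Nil
    by (intro exI[of _ "[]"]) (simp add: tx_sequence_def V_def settled_value_def)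
next
  case (Suc n)
  then obtain Tx where Tx: "tx_sequence C Tx" "attainable C F Tx (real n * C) (Online C)"
    "V A Tx \<le> real n * (C / real M)" by blast
  obtain Tx' where "tx_sequence C Tx'" "attainable C F Tx' (real n * C + C) (Online C)"
    "V A Tx' \<le> V A Tx + C / real M"
    using phase[OF Tx(1,2) assms] by blast
  with Tx(3) show ?case
    by (intro exI[of _ Tx']) (simp add: distrib_right add_divide_distrib add.commute)
qed

lemma V_nonneg: "tx_sequence C Tx \<Longrightarrow> 0 \<le> V A Tx"
  unfolding V_def settled_value_def
  by (intro sum_nonneg) (auto simp: tx_sequence_def)

text \<open>The size parameter \<open>M\<close> defeats the ratio, and the number \<open>n\<close>
  of phases then defeats the additive constant.\<close>

lemma not_competitive: "\<not> competitive C 1 F C \<alpha> A"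
proof
  assume "competitive C 1 F C \<alpha> A"
  then obtain c where c: "\<And>Tx. tx_sequence C Tx \<Longrightarrow> V_OPT C 1 F Tx \<le> \<alpha> * V A Tx + c"
    unfolding competitive_def by blast
  \<comment> \<open>This bounds the algorithm's share by half of \<open>real n * C\<close>; the
    other half exceeds \<open>c\<close> by the choice of \<open>n\<close>.\<close>
  obtain M :: nat where M: "2 * \<bar>\<alpha>\<bar> + 1 < real M" using reals_Archimedean2 by blast
  obtain n :: nat where n: "2 * c / C < real n" using reals_Archimedean2 by blast
  have M0: "M > 0" using M by (cases M) auto
  obtain Tx where Tx: "tx_sequence C Tx" "attainable C F Tx (real n * C) (Online C)"
    "V A Tx \<le> real n * (C / real M)" using phases[OF M0] by blast
  have "real n * C \<le> \<alpha> * V A Tx + c"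
    using attainable_le_V_OPT[OF Tx(2)] c[OF Tx(1)] by linarith
  \<comment> \<open>The absolute value covers negative \<open>\<alpha>\<close>.\<close>
  also have "\<alpha> * V A Tx \<le> \<bar>\<alpha>\<bar> * (real n * (C / real M))"
    using V_nonneg[OF Tx(1)] Tx(3) by (intro mult_mono) auto
  also have "\<dots> = (\<bar>\<alpha>\<bar> / real M) * (real n * C)" by simp
  also have "\<dots> \<le> (1 / 2) * (real n * C)"
    using M M0 C_pos by (intro mult_right_mono) (auto simp: field_simps)
  finally have "real n * C \<le> 2 * c" by simp
  then show False using n C_pos by (simp add: field_simps)
qed

end

theorem theorem3:
  fixes C T :: real and k F :: nat
  assumes "C > 0" and "F > 0" and "k = 1" and "T = C"
  shows "\<not> (\<exists>A \<alpha>. online_algorithm C k F T A \<and> competitive C k F T \<alpha> A)"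
  using assms one_wallet_algorithm.intro one_wallet_algorithm.not_competitive by blast

end
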